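(* Let $\alpha=1$, $k^d\in\mathbb{N}$, and let $k^t\in\mathbb{N}$ satisfy $k^t\ge\alpha\left\lceil\frac{k^d}{k^t}\right\rceil$. There is an instance $I$ of the relief distribution problem with $k^t$ trucks, $k^d$ drones and drone speed $\alpha=1$ such that $$\frac{\mathrm{Regretless}(I)}{\mathrm{OPT}(I^* )}=1+\alpha\left\lceil\frac{k^d}{k^t}\right\rceil.$$
   Context: Relief distribution problem (RDP). $\mathbb{N}=\{1,2,\dots\}$. An instance is $I=(k^t,k^d,\alpha,G,D)$: $k^t,k^d\in\mathbb{N}$ are the numbers of trucks and drones; $\alpha>0$ is the drone speed; $G=(V,E,c)$ is a finite connected undirected graph (not necessarily complete) with $V=\{v_0\}\cup C$, where $v_0$ is the depot and $C\neq\emptyset$ is the set of non-depot nodes; edge lengths $c(i,j)>0$ satisfy the triangle inequality; $D\subseteq C$ is the set of damaged nodes, initially unknown; the status of a node is revealed (instantly to all) when some vehicle first arrives at it. For non-adjacent $i,j$, $c(i,j)$ is the shortest-path distance. A truck needs time $c(i,j)$ to traverse an edge, a drone needs $\frac1\alpha c(i,j)$. A tour is a closed walk in $G$ starting and ending at $v_0$ (possibly of length $0$); it may be written as a sequence of nodes, consecutive nodes being joined by shortest paths, and $c(t)$ is the length of tour $t$. The makespan of a family of tours is the maximum duration of a tour. Full-information optimum: $\mathrm{OPT}(I^* )$ is the minimum makespan over all families of $k^t$ truck tours and $k^d$ drone tours such that every node of $C$ is visited by some vehicle and every node of $D$ is visited by a truck ($I^*$ is the instance $I$ with $D$ known in advance).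 For integers $m,n\ge 0$ with $m+n\ge1$ and $W\subseteq C$, $S^*_{m,n}(W)$ denotes a family of $m$ truck tours and $n$ drone tours together visiting all nodes of $W$ with minimum makespan. Policy Regretless (deterministic; choices among optimal solutions are made by a fixed rule using only the information available at that time, so first-stage decisions do not depend on $D$). First stage: compute $S^*_{k^t,0}(C)=\{s^*_1,\dots,s^*_{k^t}\}$, written as $s^*_i=(v_0,v_{(1)},\dots,v_{(n_i)},v_0)$ so that each node of $C$ is listed exactly once in exactly one tour. Assign one truck to each tour and distribute the drones as evenly as possible, so each tour receives $\lceil k^d/k^t\rceil$ or $\lfloor k^d/k^t\rfloor$ drones; let $k_i$ be the number of vehicles assigned to $s_i^*$. Split $(v_{(1)},\dots,v_{(n_i)})$ into up to $k_i$ consecutive nonempty segments $\Delta_i^l=(v_{(j_l)},\dots,v_{(j_{l+1}-1)})$, $j_1=1$; the truck is assigned the tour $t_i^1=(v_0,v_{(1)},\dots,v_{(j_2-1)},v_0)$ and each further segment $l\ge2$ is assigned to one drone, with the reversed tour $t_i^l=(v_0,v_{(j_{l+1}-1)},\dots,v_{(j_l)},v_0)$; the splitting is chosen to minimize $\max\{c(t_i^1),\max_{l\ge2} c(t_i^l)/\alpha\}$. All vehicles start at time $0$. Second stage (replanning), for each $i$: when truck $i$ reaches the last node $v_{(j_2-1)}$ of its segment, let $D_i^d$ be the set of damaged nodes of $s_i^*$ not yet visited by the truck and $C_i^d$ the set of nodes of $s_i^*$ not yet visited by any vehicle; the truck then follows a minimum-length walk from its current node visiting all of $D_i^d\cup C_i^d$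 and ending at $v_0$. The drones complete their tours. $\mathrm{Regretless}(I)$ is the time at which the last vehicle has returned to $v_0$. *)

theory Defs
  imports Complex_Main
begin

record 'v rdp =
  trucks :: nat
  drones :: nat
  speed :: real
  depot :: 'v
  clients :: "'v set"
  edges :: "'v set set"
  edge_len :: "'v set \<Rightarrow> real"
  damaged :: "'v set"

definition nodes :: "'v rdp \<Rightarrow> 'v set" where
  "nodes I = insert (depot I) (clients I)"

definition walk :: "'v rdp \<Rightarrow> 'v list \<Rightarrow> bool" where
  "walk I w \<longleftrightarrow> w \<noteq> [] \<and> set w \<subseteq> nodes I \<and> successively (\<lambda>i j. {i, j} \<in> edges I) w"

fun walk_len :: "'v rdp \<Rightarrow> 'v list \<Rightarrow> real" where
  "walk_len I (x # y # w) = edge_len I {x, y} + walk_len I (y # w)"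
| "walk_len I w = 0"

definition walk_between :: "'v rdp \<Rightarrow> 'v \<Rightarrow> 'v \<Rightarrow> 'v list \<Rightarrow> bool" where
  "walk_between I i j w \<longleftrightarrow> walk I w \<and> hd w = i \<and> last w = j"

definition shortest_path :: "'v rdp \<Rightarrow> 'v \<Rightarrow> 'v \<Rightarrow> 'v list \<Rightarrow> bool" where
  "shortest_path I i j w \<longleftrightarrow>
     walk_between I i j w \<and> (\<forall>w'. walk_between I i j w' \<longrightarrow> walk_len I w \<le> walk_len I w')"

text \<open>The cost extends the edge lengths to all pairs of nodes by shortest-path distances; in a
  finite connected graph with positive lengths the infimum is a minimum.\<close>

definition cost :: "'v rdp \<Rightarrow> 'v \<Rightarrow> 'v \<Rightarrow> real" where
  "cost I i j = (if {i, j} \<in> edges I then edge_len I {i, j}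
                 else Inf (walk_len I ` {w. walk_between I i j w}))"

text \<open>The triangle inequality is imposed on the extended cost function. For a graph that is not
  complete this says that no edge is longer than a path connecting its two ends, which is more than
  the inequality for the triangles contained in the graph.\<close>

definition rdp_instance :: "'v rdp \<Rightarrow> bool" where
  "rdp_instance I \<longleftrightarrow>
     trucks I \<ge> 1 \<and> drones I \<ge> 1 \<and> speed I > 0 \<and>
     finite (clients I) \<and> clients I \<noteq> {} \<and> depot I \<notin> clients I \<and>
     (\<forall>e \<in> edges I. e \<subseteq> nodes I \<and> card e = 2 \<and> edge_len I e > 0) \<and>
     (\<forall>i \<in> nodes I. \<forall>j \<in> nodes I. \<exists>w. walk_between I i j w) \<and>
     (\<forall>i \<in> nodes I. \<forall>j \<in> nodes I. \<forall>k \<in> nodes I. cost I i k \<le> cost I i j + cost I j k) \<and>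
     damaged I \<subseteq> clients I"

definition tour :: "'v rdp \<Rightarrow> 'v list \<Rightarrow> bool" where
  "tour I w \<longleftrightarrow> walk_between I (depot I) (depot I) w"

definition makespan :: "'v rdp \<Rightarrow> 'v list list \<Rightarrow> 'v list list \<Rightarrow> real" where
  "makespan I ts ds = Max (walk_len I ` set ts \<union> (\<lambda>w. walk_len I w / speed I) ` set ds)"

definition tour_family ::
  "'v rdp \<Rightarrow> nat \<Rightarrow> nat \<Rightarrow> 'v set \<Rightarrow> 'v list list \<Rightarrow> 'v list list \<Rightarrow> bool" where
  "tour_family I m n W ts ds \<longleftrightarrow>
     length ts = m \<and> length ds = n \<and> (\<forall>w \<in> set ts \<union> set ds. tour I w) \<and>
     W \<subseteq> (\<Union>w \<in> set ts \<union> set ds. set w)"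

definition optimal_family ::
  "'v rdp \<Rightarrow> nat \<Rightarrow> nat \<Rightarrow> 'v set \<Rightarrow> 'v list list \<Rightarrow> 'v list list \<Rightarrow> bool" where
  "optimal_family I m n W ts ds \<longleftrightarrow> tour_family I m n W ts ds \<and>
     (\<forall>ts' ds'. tour_family I m n W ts' ds' \<longrightarrow> makespan I ts ds \<le> makespan I ts' ds')"

text \<open>The infimum below is attained: below any bound there are only finitely many walk lengths.\<close>

definition OPT :: "'v rdp \<Rightarrow> real" where
  "OPT I = Inf {makespan I ts ds | ts ds.
     tour_family I (trucks I) (drones I) (clients I) ts ds \<and>
     damaged I \<subseteq> (\<Union>w \<in> set ts. set w)}"

text \<open>Tours written as sequences of nodes: \<open>joins I xs w\<close> says that the walk \<open>w\<close> arises
  from \<open>xs\<close> by joining consecutive nodes by shortest paths.\<close>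

fun joins :: "'v rdp \<Rightarrow> 'v list \<Rightarrow> 'v list \<Rightarrow> bool" where
  "joins I [] w \<longleftrightarrow> False"
| "joins I [x] w \<longleftrightarrow> x \<in> nodes I \<and> w = [x]"
| "joins I (x # y # xs) w \<longleftrightarrow>
     (\<exists>p q. shortest_path I x y p \<and> joins I (y # xs) q \<and> w = p @ tl q)"

fun seq_len :: "'v rdp \<Rightarrow> 'v list \<Rightarrow> real" where
  "seq_len I (x # y # xs) = cost I x y + seq_len I (y # xs)"
| "seq_len I xs = 0"

definition tour_seq :: "'v rdp \<Rightarrow> 'v list \<Rightarrow> 'v list" where
  "tour_seq I xs = depot I # xs @ [depot I]"

text \<open>An empty sequence of nodes has only the empty splitting; its truck then stays at the
  depot.\<close>

definition splitting :: "nat \<Rightarrow> 'v list \<Rightarrow> 'v list list \<Rightarrow> bool" where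
  "splitting k xs segs \<longleftrightarrow> concat segs = xs \<and> [] \<notin> set segs \<and> length segs \<le> k"

definition truck_segment :: "'v list list \<Rightarrow> 'v list" where
  "truck_segment segs = (case segs of [] \<Rightarrow> [] | seg # _ \<Rightarrow> seg)"

definition split_makespan :: "'v rdp \<Rightarrow> 'v list list \<Rightarrow> real" where
  "split_makespan I segs = Max (insert (seq_len I (tour_seq I (truck_segment segs)))
     ((\<lambda>seg. seq_len I (tour_seq I (rev seg)) / speed I) ` set (tl segs)))"

definition optimal_splitting :: "'v rdp \<Rightarrow> nat \<Rightarrow> 'v list \<Rightarrow> 'v list list \<Rightarrow> bool" where
  "optimal_splitting I k xs segs \<longleftrightarrow> splitting k xs segs \<and>
     (\<forall>segs'. splitting k xs segs' \<longrightarrow> split_makespan I segs \<le> split_makespan I segs')"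

text \<open>First-stage decisions. All lists are indexed by the tours of the optimal truck-only family:
  the listed nodes of each tour (without the depot), the number of drones it receives, its
  splitting, the walk of its truck up to the last node of the truck's segment, and the walks of
  those of its drones that receive a segment. The remaining drones stay at the depot.\<close>

record 'v plan =
  listing :: "'v list list"
  share :: "nat list"
  segments :: "'v list list list"
  truck_out :: "'v list list"
  drone_walks :: "'v list list list"

definition first_stage :: "'v rdp \<Rightarrow> 'v plan \<Rightarrow> bool" where
  "first_stage I p \<longleftrightarrow>
     distinct (concat (listing p)) \<and> set (concat (listing p)) = clients I \<and>
     (\<exists>ts. list_all2 (joins I) (map (tour_seq I) (listing p)) ts \<and>
           optimal_family I (trucks I) 0 (clients I) ts []) \<and>
     length (share p) = trucks I \<and> sum_list (share p) = drones I \<and>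
     (\<forall>n \<in> set (share p). int n \<in> {\<lfloor>real (drones I) / real (trucks I)\<rfloor>,
                                    \<lceil>real (drones I) / real (trucks I)\<rceil>}) \<and>
     length (segments p) = trucks I \<and>
     (\<forall>i < trucks I. optimal_splitting I (1 + share p ! i) (listing p ! i) (segments p ! i)) \<and>
     list_all2 (joins I) (map (\<lambda>segs. depot I # truck_segment segs) (segments p)) (truck_out p) \<and>
     list_all2 (list_all2 (joins I))
       (map (\<lambda>segs. map (\<lambda>seg. tour_seq I (rev seg)) (tl segs)) (segments p)) (drone_walks p)"

text \<open>Second stage: \<open>qs ! i\<close> is the walk of truck \<open>i\<close> from the moment of its replanning.\<close>

definition replan_time :: "'v rdp \<Rightarrow> 'v plan \<Rightarrow> nat \<Rightarrow> real" where
  "replan_time I p i = walk_len I (truck_out p ! i)"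

definition reached :: "'v rdp \<Rightarrow> real \<Rightarrow> 'v list \<Rightarrow> real \<Rightarrow> 'v set" where
  "reached I s w t = {w ! k | k. k < length w \<and> walk_len I (take (Suc k) w) / s \<le> t}"

definition visited :: "'v rdp \<Rightarrow> 'v plan \<Rightarrow> 'v list list \<Rightarrow> real \<Rightarrow> 'v set" where
  "visited I p qs t =
     (\<Union>i < trucks I. reached I 1 (truck_out p ! i @ tl (qs ! i)) t) \<union>
     (\<Union>w \<in> set (concat (drone_walks p)). reached I (speed I) w t)"

definition remaining :: "'v rdp \<Rightarrow> 'v plan \<Rightarrow> 'v list list \<Rightarrow> nat \<Rightarrow> 'v set" where
  "remaining I p qs i =
     (damaged I \<inter> set (listing p ! i) - set (truck_out p ! i)) \<union>
     (set (listing p ! i) - visited I p qs (replan_time I p i))"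

definition shortest_return :: "'v rdp \<Rightarrow> 'v \<Rightarrow> 'v set \<Rightarrow> 'v list \<Rightarrow> bool" where
  "shortest_return I x U q \<longleftrightarrow> walk_between I x (depot I) q \<and> U \<subseteq> set q \<and>
     (\<forall>q'. walk_between I x (depot I) q' \<and> U \<subseteq> set q' \<longrightarrow> walk_len I q \<le> walk_len I q')"

definition second_stage :: "'v rdp \<Rightarrow> 'v plan \<Rightarrow> 'v list list \<Rightarrow> bool" where
  "second_stage I p qs \<longleftrightarrow> length qs = trucks I \<and>
     (\<forall>i < trucks I. shortest_return I (last (truck_out p ! i)) (remaining I p qs i) (qs ! i))"

definition completion_time :: "'v rdp \<Rightarrow> 'v plan \<Rightarrow> 'v list list \<Rightarrow> real" where
  "completion_time I p qs =
     Max ((\<lambda>i. walk_len I (truck_out p ! i) + walk_len I (qs ! i)) ` {..<trucks I} \<union>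
          (\<lambda>w. walk_len I w / speed I) ` set (concat (drone_walks p)))"

text \<open>A deterministic version of the policy, that is, a rule resolving every choice: \<open>plan_of\<close> makes
  the first-stage decisions and \<open>returns_of\<close> selects the return walks. The last clause expresses
  that only the available information is used: the plan does not depend on the damaged nodes, and
  the return walk of a truck depends only on the status of nodes visited when the truck replans.\<close>

record 'v policy =
  plan_of :: "'v rdp \<Rightarrow> 'v plan"
  returns_of :: "'v rdp \<Rightarrow> 'v list list"

definition regretless_policy :: "'v policy \<Rightarrow> bool" where
  "regretless_policy \<pi> \<longleftrightarrow>
     (\<forall>I. rdp_instance I \<longrightarrow>
        first_stage I (plan_of \<pi> I) \<and> second_stage I (plan_of \<pi> I) (returns_of \<pi> I)) \<and>
     (\<forall>I D. rdp_instance I \<and> D \<subseteq> clients I \<longrightarrow>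
        plan_of \<pi> (I\<lparr>damaged := D\<rparr>) = plan_of \<pi> I \<and>
        (\<forall>i < trucks I.
           visited I (plan_of \<pi> I) (returns_of \<pi> I) (replan_time I (plan_of \<pi> I) i) \<inter> D =
           visited I (plan_of \<pi> I) (returns_of \<pi> I) (replan_time I (plan_of \<pi> I) i) \<inter> damaged I
           \<longrightarrow> returns_of \<pi> (I\<lparr>damaged := D\<rparr>) ! i = returns_of \<pi> I ! i))"

definition Regretless :: "'v policy \<Rightarrow> 'v rdp \<Rightarrow> real" where
  "Regretless \<pi> I = completion_time I (plan_of \<pi> I) (returns_of \<pi> I)"

end

theory Submission
  imports Defs
begin

text \<open>Let \<open>m = \<lceil>kd / kt\<rceil>\<close> and take the star with the depot as centre and \<open>kt + kd\<close> leaves at distance 1,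
  one for each vehicle. The first stage lists at most \<open>m + 1\<close> leaves per truck, and by the pigeonhole
  principle exactly \<open>m + 1\<close> for some truck. The adversary damages those of its leaves that
  are outside the truck's own segment, so this truck visits \<open>m + 1\<close> leaves, at 2 time units each.
  The segment is nonempty, so at most \<open>m \<le> kt\<close> leaves are damaged, and with full information every
  vehicle serves a single leaf, the trucks taking the damaged ones.\<close>

section \<open>The star instance\<close>

definition star :: "nat \<Rightarrow> nat \<Rightarrow> nat set \<Rightarrow> nat rdp" where
  "star kt kd D = \<lparr>trucks = kt, drones = kd, speed = 1, depot = 0, clients = {1..kt + kd},
     edges = (\<lambda>i. {0, i}) ` {1..kt + kd}, edge_len = (\<lambda>_. 1), damaged = D\<rparr>"

lemma star_simps [simp]:
  "trucks (star kt kd D) = kt" "drones (star kt kd D) = kd" "speed (star kt kd D) = 1"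
  "depot (star kt kd D) = 0" "clients (star kt kd D) = {1..kt + kd}"
  "edge_len (star kt kd D) e = 1" "damaged (star kt kd D) = D"
  by (simp_all add: star_def)

lemma damaged_update_star: "star kt kd D\<lparr>damaged := D'\<rparr> = star kt kd D'"
  by (simp add: star_def)

lemma nodes_star: "nodes (star kt kd D) = {..kt + kd}"
  by (auto simp: nodes_def)

lemma edge_star_iff:
  "{x, y} \<in> edges (star kt kd D) \<longleftrightarrow>
     x \<le> kt + kd \<and> y \<le> kt + kd \<and> (x = 0) \<noteq> (y = 0)"
  by (force simp: star_def doubleton_eq_iff image_iff)

section \<open>Walk lengths in terms of visited leaves\<close>

definition num_leaves :: "nat list \<Rightarrow> nat" where
  "num_leaves w = length (filter (\<lambda>x. x \<noteq> 0) w)"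

text \<open>On the nodes of the star this is the distance to the depot; two distinct nodes
  \<open>x\<close> and \<open>y\<close> are at distance \<open>nz x + nz y\<close>.\<close>

definition nz :: "nat \<Rightarrow> real" where
  "nz x = of_bool (x \<noteq> 0)"

lemma nz_simps [simp]: "nz 0 = 0" "x \<noteq> 0 \<Longrightarrow> nz x = 1" "nz x \<le> 1" "0 \<le> nz x"
  by (simp_all add: nz_def)

lemma num_leaves_simps [simp]:
  "num_leaves [] = 0"
  "real (num_leaves (x # w)) = nz x + real (num_leaves w)"
  "num_leaves (v @ w) = num_leaves v + num_leaves w"
  "num_leaves (rev w) = num_leaves w"
  by (simp_all add: num_leaves_def nz_def flip: rev_filter)

lemma num_leaves_le_length: "num_leaves w \<le> length w"
  by (simp add: num_leaves_def)

text \<open>Combined with the exact length formula \<open>walk_len_star\<close>, this turns a set of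
  leaves that must be visited into a lower bound on length: 2 per leaf for a closed walk at the
  depot.\<close>

lemma card_le_num_leaves:
  assumes "U \<subseteq> set w" "0 \<notin> U"
  shows "card U \<le> num_leaves w"
proof -
  have "card U \<le> card (set (filter (\<lambda>x. x \<noteq> 0) w))"
    using assms by (intro card_mono) (auto intro: gr0I)
  also have "\<dots> \<le> num_leaves w"
    unfolding num_leaves_def by (rule card_length)
  finally show ?thesis .
qed

text \<open>Every edge has exactly one leaf as an end point, so each inner leaf of a walk is charged for
  two edges.\<close>

lemma walk_len_star:
  assumes "walk (star kt kd D) w"
  shows "walk_len (star kt kd D) w = 2 * real (num_leaves w) - nz (hd w) - nz (last w)"
  using assms
proof (induction "star kt kd D" w rule: walk_len.induct)
  case (1 x y w)
  then have "walk (star kt kd D) (y # w)" and "{x, y} \<in> edges (star kt kd D)"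
    by (auto simp: walk_def)
  moreover have "nz x + nz y = 1"
    using calculation(2) unfolding edge_star_iff by (auto simp: nz_def)
  ultimately show ?case
    using 1(1) by auto
qed (auto simp: walk_def)

lemma walk_len_append_tl:
  assumes "v \<noteq> []" "w \<noteq> []" "hd w = last v"
  shows "walk_len I (v @ tl w) = walk_len I v + walk_len I w"
proof -
  obtain x w' where w: "w = x # w'"
    using assms(2) by (meson list.exhaust)
  have "walk_len I (v @ w') = walk_len I v + walk_len I (last v # w')"
    using assms(1) by (induction I v rule: walk_len.induct) auto
  then show ?thesis
    using assms(3) w by simp
qed

lemma walk_between_append_tl:
  assumes "walk_between I i j v" "walk_between I j k w"
  shows "walk_between I i k (v @ tl w)"
proof -
  obtain w' where w: "w = j # w'"
    using assms(2) by (cases w) (auto simp: walk_between_def walk_def)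
  show ?thesis
    using assms unfolding w walk_between_def walk_def
    by (auto simp: successively_append_iff successively_Cons last_append)
qed

lemma walk_len_nonneg_star: "0 \<le> walk_len (star kt kd D) w"
  by (induction "star kt kd D" w rule: walk_len.induct) auto

section \<open>Explicit tours and distances in the star\<close>

text \<open>Serves the listed leaves one by one with a return to the depot after each, at 2 time
  units per leaf. The base case supplies the final return, and the empty list gives the tour that
  stays at the depot.\<close>

fun star_tour :: "nat list \<Rightarrow> nat list" where
  "star_tour [] = [0]"
| "star_tour (u # us) = 0 # u # star_tour us"

lemma hd_star_tour [simp]: "hd (star_tour us) = 0"
  by (cases us) auto

lemma star_tour_neq_Nil [simp]: "star_tour us \<noteq> []"
  by (cases us) auto

lemma set_star_tour: "set (star_tour us) = insert 0 (set us)"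
  by (induction us) auto

lemma walk_len_star_tour: "walk_len (star kt kd D) (star_tour us) = 2 * real (length us)"
proof (induction us)
  case (Cons u us)
  then show ?case
    by (cases us) auto
qed auto

lemma walk_between_star_tour:
  assumes "set us \<subseteq> {1..kt + kd}"
  shows "walk_between (star kt kd D) 0 0 (star_tour us)"
  using assms
proof (induction us)
  case (Cons u us)
  then show ?case
    by (auto simp: walk_between_def walk_def nodes_star successively_Cons edge_star_iff)
qed (auto simp: walk_between_def walk_def nodes_star)

lemma tour_star_tour: "set us \<subseteq> {1..kt + kd} \<Longrightarrow> tour (star kt kd D) (star_tour us)"
  by (simp add: tour_def walk_between_star_tour)

text \<open>Two distinct leaves are joined through the centre. As \<open>nz 0 = 0\<close>, one
  formula covers all pairs of distinct nodes.\<close>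

lemma short_walk_star:
  assumes "x \<le> kt + kd" "y \<le> kt + kd"
  obtains w where "walk_between (star kt kd D) x y w"
    "walk_len (star kt kd D) w \<le> (if x = y then 0 else nz x + nz y)"
proof -
  define w where "w = (if x = y then [x] else if x = 0 \<or> y = 0 then [x, y] else [x, 0, y])"
  have "walk_between (star kt kd D) x y w"
    using assms by (auto simp: w_def walk_between_def walk_def nodes_star edge_star_iff)
  moreover have "walk_len (star kt kd D) w \<le> (if x = y then 0 else nz x + nz y)"
    by (auto simp: w_def nz_def)
  ultimately show ?thesis
    by (rule that)
qed

lemma walk_len_ge_star:
  assumes "walk_between (star kt kd D) x y w"
  shows "(if x = y then 0 else nz x + nz y) \<le> walk_len (star kt kd D) w"
proof (cases "x = y")
  case False
  have w: "walk (star kt kd D) w" "hd w = x" "last w = y" "w \<noteq> []"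
    using assms by (auto simp: walk_between_def walk_def)
  \<comment> \<open>Only end points that are leaves count; each contributes 2 - 1 = 1 to the formula
    of \<open>walk_len_star\<close>.\<close>
  then have "{x, y} - {0} \<subseteq> set w"
    by auto
  then have "card ({x, y} - {0}) \<le> num_leaves w"
    by (rule card_le_num_leaves) auto
  moreover have "real (card ({x, y} - {0})) = nz x + nz y"
    using False by (cases "x = 0"; cases "y = 0") (auto simp: card_insert_if insert_Diff_if)
  ultimately show ?thesis
    using walk_len_star[OF w(1)] w False by simp
qed (simp add: walk_len_nonneg_star)

lemma cost_star:
  assumes "x \<le> kt + kd" "y \<le> kt + kd"
  shows "cost (star kt kd D) x y = (if x = y then 0 else nz x + nz y)"
proof (cases "{x, y} \<in> edges (star kt kd D)")
  case True
  then show ?thesis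
    unfolding edge_star_iff cost_def by (auto simp: nz_def edge_star_iff)
next
  case False
  \<comment> \<open>Here \<open>cost\<close> is an infimum, attained by the short walk. The case
    includes \<open>x = y\<close>, with a walk of one node.\<close>
  obtain w where w: "walk_between (star kt kd D) x y w"
    "walk_len (star kt kd D) w \<le> (if x = y then 0 else nz x + nz y)"
    using short_walk_star assms by blast
  have "Inf (walk_len (star kt kd D) ` {w. walk_between (star kt kd D) x y w}) =
      walk_len (star kt kd D) w"
  proof (rule cInf_eq_minimum)
    show "walk_len (star kt kd D) w \<le> l"
      if "l \<in> walk_len (star kt kd D) ` {w. walk_between (star kt kd D) x y w}" for l
    proof -
      obtain w' where w': "walk_between (star kt kd D) x y w'" "l = walk_len (star kt kd D) w'"
        using \<open>l \<in> _\<close> by auto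
      show ?thesis
        using w(2) walk_len_ge_star[OF w'(1)] w'(2) by linarith
    qed
  qed (use w in auto)
  then show ?thesis
    using False w(2) walk_len_ge_star[OF w(1)] by (simp add: cost_def)
qed

lemma rdp_instance_star:
  assumes "kt \<ge> 1" "kd \<ge> 1" "D \<subseteq> {1..kt + kd}"
  shows "rdp_instance (star kt kd D)"
  unfolding rdp_instance_def
proof (intro conjI ballI)
  fix e
  assume e: "e \<in> edges (star kt kd D)"
  then obtain i where "i \<in> {1..kt + kd}" "e = {0, i}"
    by (auto simp: star_def)
  then show "e \<subseteq> nodes (star kt kd D)" "card e = 2"
    by (auto simp: nodes_star)
next
  fix i j
  assume "i \<in> nodes (star kt kd D)" "j \<in> nodes (star kt kd D)"
  then show "\<exists>w. walk_between (star kt kd D) i j w"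
    unfolding nodes_star using short_walk_star[of i kt kd j D] by auto
next
  fix i j k
  assume "i \<in> nodes (star kt kd D)" "j \<in> nodes (star kt kd D)" "k \<in> nodes (star kt kd D)"
  then show "cost (star kt kd D) i k \<le> cost (star kt kd D) i j + cost (star kt kd D) j k"
    by (auto simp: nodes_star cost_star nz_def)
qed (use assms in auto)

section \<open>Walks that join sequences of nodes\<close>

lemma joins_walk_between:
  assumes "joins I xs w"
  shows "walk_between I (hd xs) (last xs) w \<and> set xs \<subseteq> set w"
  using assms
proof (induction I xs w rule: joins.induct)
  case (3 I x y xs w)
  then obtain p q where pq: "shortest_path I x y p" "joins I (y # xs) q" "w = p @ tl q"
    by auto
  have p: "walk_between I x y p"
    using pq(1) by (simp add: shortest_path_def)
  have q: "walk_between I y (last (y # xs)) q" "set (y # xs) \<subseteq> set q"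
    using 3(1) pq(2) by auto
  have xy: "x \<in> set p" "y \<in> set p"
    using p by (auto simp: walk_between_def walk_def)
  \<comment> \<open>Dropping the head of \<open>q\<close> loses only \<open>y\<close>, which is
    already the last node of \<open>p\<close>.\<close>
  have "set q \<subseteq> insert y (set (tl q))"
    using q(1) by (cases q) (auto simp: walk_between_def walk_def)
  then have "set (x # y # xs) \<subseteq> set w"
    using q(2) xy unfolding pq(3) by auto
  then show ?case
    using walk_between_append_tl[OF p q(1)] pq(3) by simp
qed (auto simp: walk_between_def walk_def)

text \<open>Consecutive entries cost at most \<open>nz x + nz y\<close>, so inner entries are
  charged twice and the two outer ones once. Unlike \<open>walk_len_star\<close> this is only an
  upper bound, because equal consecutive entries cost nothing.\<close>

lemma walk_len_joins_le_star:
  assumes "joins (star kt kd D) xs w" "set xs \<subseteq> {..kt + kd}"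
  shows "walk_len (star kt kd D) w \<le> 2 * real (num_leaves xs) - nz (hd xs) - nz (last xs)"
  using assms
proof (induction "star kt kd D" xs w rule: joins.induct)
  case (3 x y xs w)
  let ?I = "star kt kd D"
  from 3(2) obtain p q where pq: "shortest_path ?I x y p" "joins ?I (y # xs) q" "w = p @ tl q"
    by auto
  have "walk_between ?I x y p"
    using pq(1) by (simp add: shortest_path_def)
  moreover have "walk_between ?I y (last (y # xs)) q"
    using joins_walk_between[OF pq(2)] by simp
  ultimately have w: "walk_len ?I w = walk_len ?I p + walk_len ?I q"
    unfolding pq(3) by (intro walk_len_append_tl) (auto simp: walk_between_def walk_def)
  obtain v where v: "walk_between ?I x y v" "walk_len ?I v \<le> (if x = y then 0 else nz x + nz y)"
    using short_walk_star 3(3) by (metis atMost_iff list.set_intros subset_code(1))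
  have "(if x = y then 0 else nz x + nz y) \<le> nz x + nz y"
    by simp
  moreover have "walk_len ?I p \<le> walk_len ?I v"
    using pq(1) v(1) by (simp add: shortest_path_def)
  moreover have "walk_len ?I q \<le> 2 * real (num_leaves (y # xs)) - nz y - nz (last (y # xs))"
    using 3(1) pq(2) 3(3) by simp
  ultimately show ?case
    using w v(2) by simp
qed auto

section \<open>Makespans and the full-information optimum\<close>

text \<open>At speed 1 drones and trucks take the same time, so a single bound on walk lengths
  treats both.\<close>

lemma makespan_star:
  assumes "length ts + length ds > 0"
  shows "makespan (star kt kd D) ts ds \<le> b \<longleftrightarrow>
    (\<forall>w \<in> set ts \<union> set ds. walk_len (star kt kd D) w \<le> b)"
  using assms unfolding makespan_def by (subst Max_le_iff) auto

lemma OPT_star: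
  assumes "kt \<ge> 1" "D \<subseteq> {1..kt + kd}" "card D \<le> kt"
  shows "OPT (star kt kd D) = 2"
proof -
  let ?I = "star kt kd D"
  let ?feas = "\<lambda>ts ds. tour_family ?I kt kd {1..kt + kd} ts ds \<and> D \<subseteq> (\<Union>w \<in> set ts. set w)"
  have ge: "2 \<le> makespan ?I ts ds" if fam: "tour_family ?I kt kd {1..kt + kd} ts ds" for ts ds
  proof -
    \<comment> \<open>Leaf 1 exists because \<open>kt \<ge> 1\<close>, and serving this single leaf
      already takes 2 time units.\<close>
    have "1 \<in> (\<Union>w \<in> set ts \<union> set ds. set w)"
      using fam assms(1) by (auto simp: tour_family_def subset_iff)
    then obtain w where w: "w \<in> set ts \<union> set ds" "1 \<in> set w"
      by blast
    then have "walk_between ?I 0 0 w"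
      using fam by (auto simp: tour_family_def tour_def)
    then have "walk_len ?I w = 2 * real (num_leaves w)"
      using walk_len_star[of kt kd D w] by (simp add: walk_between_def)
    moreover have "card {1::nat} \<le> num_leaves w"
      using w(2) by (intro card_le_num_leaves) auto
    ultimately have "2 \<le> walk_len ?I w"
      by simp
    moreover have "walk_len ?I w \<le> makespan ?I ts ds"
      using makespan_star[of ts ds kt kd D "makespan ?I ts ds"] w(1)
      by (cases ts; cases ds) auto
    ultimately show ?thesis
      by linarith
  qed
  \<comment> \<open>The damaged leaves come first and number at most \<open>kt\<close>, so the first
    \<open>kt\<close> entries, one for each truck, contain them all.\<close>
  define cs where "cs = sorted_list_of_set D @ sorted_list_of_set ({1..kt + kd} - D)"
  define ts where "ts = map (\<lambda>u. star_tour [u]) (take kt cs)"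
  define ds where "ds = map (\<lambda>u. star_tour [u]) (drop kt cs)"
  have fin: "finite D"
    using assms(2) finite_subset by blast
  have set_cs: "set cs = {1..kt + kd}"
    using fin assms(2) by (auto simp: cs_def)
  have len_cs: "length cs = kt + kd"
    using fin assms(2) card_mono[OF _ assms(2)] by (simp add: cs_def card_Diff_subset)
  have set_eq: "set (take kt cs) \<union> set (drop kt cs) = {1..kt + kd}"
    by (metis append_take_drop_id set_append set_cs)
  have "tour_family ?I kt kd {1..kt + kd} ts ds"
    unfolding tour_family_def
  proof (intro conjI ballI)
    show "{1..kt + kd} \<subseteq> (\<Union>w \<in> set ts \<union> set ds. set w)"
      unfolding set_eq[symmetric] by (auto simp: ts_def ds_def)
    show "tour ?I w" if "w \<in> set ts \<union> set ds" for w
    proof -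
      have "w \<in> (\<lambda>u. star_tour [u]) ` (set (take kt cs) \<union> set (drop kt cs))"
        using that unfolding ts_def ds_def by auto
      then obtain u where "u \<in> {1..kt + kd}" "w = star_tour [u]"
        unfolding set_eq by blast
      then show ?thesis
        using tour_star_tour[of "[u]" kt kd D] by auto
    qed
  qed (simp_all add: ts_def ds_def len_cs)
  moreover have "D \<subseteq> set (take kt cs)"
    using fin assms(3) by (auto simp: cs_def)
  then have "D \<subseteq> (\<Union>w \<in> set ts. set w)"
    by (auto simp: ts_def)
  ultimately have feas: "?feas ts ds"
    by blast
  have "makespan ?I ts ds \<le> 2"
    using assms(1) len_cs by (subst makespan_star) (auto simp: ts_def ds_def)
  with ge feas have "makespan ?I ts ds = 2"
    by (intro antisym) auto
  with ge feas have "Inf {makespan ?I ts ds |ts ds. ?feas ts ds} = 2"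
    by (intro cInf_eq_minimum) auto
  then show ?thesis
    by (simp add: OPT_def)
qed

section \<open>First stage: listings and segments\<close>

text \<open>The optimal family is compared with one that gives each truck a block of at most
  \<open>M\<close> consecutive leaves; \<open>kt\<close> such blocks suffice because
  \<open>kt + kd \<le> kt * M\<close>.\<close>

lemma optimal_truck_makespan_star:
  assumes "kt \<ge> 1" "kt + kd \<le> kt * M" "optimal_family (star kt kd D) kt 0 {1..kt + kd} ts []"
    and "w \<in> set ts"
  shows "walk_len (star kt kd D) w \<le> 2 * real M"
proof -
  let ?I = "star kt kd D"
  \<comment> \<open>Blocks start at 1 because 0 is the depot; the filter cuts off numbers beyond the
    last leaf, so late blocks may be short or empty.\<close>
  define blk where "blk i = filter (\<lambda>j. j \<le> kt + kd) [i * M + 1 ..< i * M + 1 + M]" for i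
  define ts' where "ts' = map (\<lambda>i. star_tour (blk i)) [0..<kt]"
  have "tour_family ?I kt 0 {1..kt + kd} ts' []"
    unfolding tour_family_def
  proof (intro conjI ballI subsetI)
    fix j assume j: "j \<in> {1..kt + kd}"
    \<comment> \<open>Leaf \<open>j\<close> lies in block \<open>(j - 1) div M\<close>; the shift by
      one matches the numbering of leaves from 1.\<close>
    then have "j - 1 < kt * M"
      using assms(2) by auto
    then have "M > 0" and "(j - 1) div M < kt"
      by (auto simp: less_mult_imp_div_less intro: gr0I)
    moreover have "(j - 1) div M * M + 1 \<le> j" "j < (j - 1) div M * M + 1 + M"
      using j div_mult_mod_eq[of "j - 1" M] mod_less_divisor[OF \<open>M > 0\<close>, of "j - 1"]
      unfolding atLeastAtMost_iff by linarith+
    then have "j \<in> set (blk ((j - 1) div M))"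
      using j unfolding blk_def set_filter set_upt by simp
    ultimately show "j \<in> (\<Union>w \<in> set ts' \<union> set []. set w)"
      by (auto simp: ts'_def set_star_tour)
  next
    fix w assume "w \<in> set ts' \<union> set []"
    then obtain i where "w = star_tour (blk i)"
      by (auto simp: ts'_def)
    moreover have "set (blk i) \<subseteq> {1..kt + kd}"
      unfolding blk_def by auto
    ultimately show "tour ?I w"
      by (simp add: tour_star_tour)
  qed (simp_all add: ts'_def)
  then have "makespan ?I ts [] \<le> makespan ?I ts' []"
    using assms(3) by (auto simp: optimal_family_def)
  also have "length (blk i) \<le> M" for i
    unfolding blk_def by (rule order_trans[OF length_filter_le]) simp
  then have "makespan ?I ts' [] \<le> 2 * real M"
    using assms(1) by (subst makespan_star) (auto simp: ts'_def walk_len_star_tour)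
  finally show ?thesis
    using assms(4) by (subst (asm) makespan_star) auto
qed

lemma set_listing_star:
  assumes "first_stage (star kt kd D) p" "xs \<in> set (listing p)"
  shows "set xs \<subseteq> {1..kt + kd}" "distinct xs"
proof -
  have "distinct (concat (listing p))" and "set (concat (listing p)) = {1..kt + kd}"
    using assms(1) unfolding first_stage_def star_simps by blast+
  then show "set xs \<subseteq> {1..kt + kd}" "distinct xs"
    using assms(2) by (auto simp: distinct_concat_iff)
qed

text \<open>The walk of a truck passes through all the distinct leaves of its listing, hence is at
  least twice as long as the listing, while optimality bounds it by \<open>2 * M\<close>.\<close>

lemma length_listing_star:
  assumes "kt \<ge> 1" "kt + kd \<le> kt * M" "first_stage (star kt kd D) p"
  shows "length (listing p) = kt" and "xs \<in> set (listing p) \<Longrightarrow> length xs \<le> M"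
proof -
  let ?I = "star kt kd D"
  obtain ts where ts: "list_all2 (joins ?I) (map (tour_seq ?I) (listing p)) ts"
    and opt: "optimal_family ?I kt 0 {1..kt + kd} ts []"
    using assms(3) unfolding first_stage_def star_simps by blast
  show len: "length (listing p) = kt"
  proof -
    have "length ts = kt"
      using opt unfolding optimal_family_def tour_family_def by blast
    then show ?thesis
      using list_all2_lengthD[OF ts] by simp
  qed
  show "length xs \<le> M" if xs: "xs \<in> set (listing p)"
  proof -
    obtain i where i: "i < kt" "xs = listing p ! i"
      using xs unfolding in_set_conv_nth len by blast
    have "joins ?I (tour_seq ?I xs) (ts ! i)"
      using list_all2_nthD[OF ts, of i] i len by simp
    note j = joins_walk_between[OF this]
    have w: "walk ?I (ts ! i)" "hd (ts ! i) = 0" "last (ts ! i) = 0"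
      using j by (auto simp: walk_between_def tour_seq_def)
    have "set xs \<subseteq> {1..kt + kd}" and "distinct xs"
      using set_listing_star[OF assms(3) xs] by auto
    moreover have "set xs \<subseteq> set (ts ! i)"
      using j by (auto simp: tour_seq_def)
    ultimately have "length xs \<le> num_leaves (ts ! i)"
      using card_le_num_leaves[of "set xs" "ts ! i"] distinct_card[of xs] by force
    moreover have "ts ! i \<in> set ts"
      using i len list_all2_lengthD[OF ts] by simp
    then have "walk_len ?I (ts ! i) \<le> 2 * real M"
      using optimal_truck_makespan_star[OF assms(1,2) opt] by blast
    ultimately show ?thesis
      using walk_len_star[OF w(1)] w by simp
  qed
qed

text \<open>A splitting has no empty segments, so a truck with a nonempty listing keeps at least one
  leaf for itself; together with the length identity this later bounds the number of damaged
  leaves.\<close>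

lemma truck_out_star:
  assumes "first_stage (star kt kd D) p" "i < kt"
  defines "seg \<equiv> truck_segment (segments p ! i)"
  shows "joins (star kt kd D) (0 # seg) (truck_out p ! i)"
    and "concat (segments p ! i) = listing p ! i" and "seg = [] \<longleftrightarrow> listing p ! i = []"
    and "set seg \<subseteq> set (listing p ! i)"
    and "length (concat (tl (segments p ! i))) + length seg = length (listing p ! i)"
proof -
  let ?I = "star kt kd D"
  have len: "length (segments p) = kt"
    and all: "list_all2 (joins ?I) (map (\<lambda>segs. 0 # truck_segment segs) (segments p)) (truck_out p)"
    and opt: "optimal_splitting ?I (1 + share p ! i) (listing p ! i) (segments p ! i)"
    using assms(1,2) unfolding first_stage_def star_simps by blast+
  show "joins ?I (0 # seg) (truck_out p ! i)"
    using list_all2_nthD[OF all, of i] len assms(2) by (simp add: seg_def)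
  show c: "concat (segments p ! i) = listing p ! i"
    using opt by (auto simp: optimal_splitting_def splitting_def)
  have "[] \<notin> set (segments p ! i)"
    using opt by (auto simp: optimal_splitting_def splitting_def)
  then show "seg = [] \<longleftrightarrow> listing p ! i = []" "set seg \<subseteq> set (listing p ! i)"
    "length (concat (tl (segments p ! i))) + length seg = length (listing p ! i)"
    unfolding c[symmetric] seg_def truck_segment_def by (cases "segments p ! i"; force)+
qed

section \<open>Second stage: completion times\<close>

lemma walk_len_take_le_star: "walk_len (star kt kd D) (take k w) \<le> walk_len (star kt kd D) w"
proof (induction "star kt kd D" w arbitrary: k rule: walk_len.induct)
  case (1 x y w)
  show ?case
  proof (cases "k \<le> 1")
    case True
    then have "k = 0 \<or> k = 1"
      by auto
    then show ?thesis
      using walk_len_nonneg_star[of kt kd D "x # y # w"] by auto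
  next
    case False
    then obtain k' where k: "k = Suc (Suc k')"
      by (metis One_nat_def not_less_eq_eq Suc_le_D)
    show ?thesis
      using 1[of "Suc k'"] by (simp add: k)
  qed
qed (auto simp: take_Cons')

text \<open>A prefix of the outward walk is no longer than the whole walk, whose length is the
  replanning time. Hence no leaf of the truck's own segment can remain when it replans.\<close>

lemma truck_out_visited:
  assumes "i < kt"
  shows "set (truck_out p ! i) \<subseteq>
    visited (star kt kd D) p qs (replan_time (star kt kd D) p i)"
proof
  let ?I = "star kt kd D" and ?o = "truck_out p ! i"
  fix x assume "x \<in> set ?o"
  then obtain k where k: "k < length ?o" "x = ?o ! k"
    by (metis in_set_conv_nth)
  have "x \<in> reached ?I 1 (?o @ tl (qs ! i)) (replan_time ?I p i)"
    unfolding reached_def replan_time_def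
    using k walk_len_take_le_star[of kt kd D "Suc k" ?o]
    by (auto intro!: exI[of _ k] simp: nth_append)
  then show "x \<in> visited ?I p qs (replan_time ?I p i)"
    using assms by (auto simp: visited_def)
qed

text \<open>The outward walk saves \<open>nz\<close> of its last node, since it stops there. A
  possible return goes to the depot first, which costs just this amount, and then serves the
  remaining leaves at 2 each; these all lie outside the segment.\<close>

lemma truck_time_le_star:
  assumes "first_stage (star kt kd D) p" "second_stage (star kt kd D) p qs"
    and "i < kt" "length (listing p) = kt"
  shows "walk_len (star kt kd D) (truck_out p ! i) + walk_len (star kt kd D) (qs ! i)
    \<le> 2 * real (length (listing p ! i))"
proof -
  let ?I = "star kt kd D" and ?o = "truck_out p ! i" and ?R = "remaining (star kt kd D) p qs i"
  define seg where "seg = truck_segment (segments p ! i)"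
  note t = truck_out_star[OF assms(1,3), folded seg_def]
  have xs: "set (listing p ! i) \<subseteq> {1..kt + kd}" "distinct (listing p ! i)"
    using set_listing_star[OF assms(1)] assms(3,4) by auto
  have dseg: "distinct seg"
    using t(2) xs(2) unfolding seg_def truck_segment_def
    by (cases "segments p ! i") (auto simp flip: t(2))
  have seg: "set seg \<subseteq> {1..kt + kd}"
    using t(4) xs(1) by blast
  have o: "walk_between ?I 0 (last (0 # seg)) ?o" "set (0 # seg) \<subseteq> set ?o"
    using joins_walk_between[OF t(1)] by auto
  have lo: "walk_len ?I ?o \<le> 2 * real (num_leaves seg) - nz (last (0 # seg))"
    using walk_len_joins_le_star[OF t(1)] seg by force
  have R: "?R \<subseteq> set (listing p ! i) - set seg"
    using truck_out_visited[OF assms(3), of p kd D qs] o(2) unfolding remaining_def by auto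
  then have finR: "finite ?R"
    using finite_subset by blast
  have "card ?R \<le> card (set (listing p ! i) - set seg)"
    using R by (intro card_mono) auto
  also have "\<dots> = length (listing p ! i) - length seg"
    using t(4) xs(2) dseg by (simp add: card_Diff_subset distinct_card)
  finally have cR: "card ?R \<le> length (listing p ! i) - length seg" .
  define v where "v = star_tour (sorted_list_of_set ?R)"
  have v: "walk_between ?I 0 0 v" "?R \<subseteq> set v"
  proof -
    have "?R \<subseteq> {1..kt + kd}"
      using R xs(1) by blast
    then show "walk_between ?I 0 0 v" "?R \<subseteq> set v"
      using finR walk_between_star_tour[of "sorted_list_of_set ?R" kt kd D]
      unfolding v_def by (auto simp: set_star_tour)
  qed
  \<comment> \<open>For an empty segment this node is the depot itself.\<close>
  have "last (0 # seg) \<le> kt + kd"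
    using seg by (cases "seg = []") (auto simp: subset_iff)
  then obtain u where u: "walk_between ?I (last (0 # seg)) 0 u"
    "walk_len ?I u \<le> (if last (0 # seg) = 0 then 0 else nz (last (0 # seg)) + nz 0)"
    using short_walk_star[of "last (0 # seg)" kt kd 0 D] by auto
  have "walk_len ?I (u @ tl v) = walk_len ?I u + walk_len ?I v"
    using u v by (intro walk_len_append_tl) (auto simp: walk_between_def walk_def)
  moreover have "walk_len ?I v = 2 * real (card ?R)"
    by (simp add: v_def walk_len_star_tour)
  moreover have "walk_len ?I u \<le> nz (last (0 # seg))"
    using u(2) by (auto split: if_splits)
  moreover have "walk_len ?I (qs ! i) \<le> walk_len ?I (u @ tl v)"
  proof -
    have "shortest_return ?I (last (0 # seg)) ?R (qs ! i)"
      using assms(2,3) o(1) by (auto simp: second_stage_def walk_between_def)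
    moreover have "walk_between ?I (last (0 # seg)) 0 (u @ tl v)"
      by (rule walk_between_append_tl[OF u(1) v(1)])
    \<comment> \<open>The head dropped from \<open>v\<close> is the depot, which is not in
      \<open>?R\<close>.\<close>
    moreover have "set v = insert 0 (set (tl v))"
      unfolding v_def by (metis hd_star_tour list.collapse list.simps(15) star_tour_neq_Nil)
    then have "?R \<subseteq> set (u @ tl v)"
      using R xs(1) v(2) by fastforce
    ultimately show ?thesis
      unfolding shortest_return_def star_simps by blast
  qed
  ultimately have "walk_len ?I (qs ! i) \<le> nz (last (0 # seg)) + 2 * real (card ?R)"
    by linarith
  then have "walk_len ?I ?o + walk_len ?I (qs ! i) \<le> 2 * real (num_leaves seg + card ?R)"
    using lo by simp
  also have "num_leaves seg + card ?R \<le> length (listing p ! i)"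
    using cR num_leaves_le_length[of seg] t(5) by linarith
  finally show ?thesis
    by simp
qed

text \<open>A listed leaf missed by the outward walk lies outside the segment, so it is damaged and
  needs the truck even if a drone has seen it. The outward and return walks thus form a closed walk
  through all listed leaves.\<close>

lemma truck_time_ge_star:
  assumes "first_stage (star kt kd D) p" "second_stage (star kt kd D) p qs"
    and "i < kt" "length (listing p) = kt"
    and "set (listing p ! i) \<subseteq> set (truck_segment (segments p ! i)) \<union> D"
  shows "2 * real (length (listing p ! i))
    \<le> walk_len (star kt kd D) (truck_out p ! i) + walk_len (star kt kd D) (qs ! i)"
proof -
  let ?I = "star kt kd D" and ?o = "truck_out p ! i" and ?q = "qs ! i"
  note t = truck_out_star[OF assms(1,3)]
  have xs: "set (listing p ! i) \<subseteq> {1..kt + kd}" "distinct (listing p ! i)"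
    using set_listing_star[OF assms(1)] assms(3,4) by auto
  have o: "walk_between ?I 0 (last ?o) ?o" "set (truck_segment (segments p ! i)) \<subseteq> set ?o"
    using joins_walk_between[OF t(1)] by (auto simp: walk_between_def)
  have q: "walk_between ?I (last ?o) 0 ?q" "remaining ?I p qs i \<subseteq> set ?q"
    using assms(2,3) by (auto simp: second_stage_def shortest_return_def)
  have w: "walk_between ?I 0 0 (?o @ tl ?q)"
    by (rule walk_between_append_tl[OF o(1) q(1)])
  have "set (listing p ! i) - set ?o \<subseteq> remaining ?I p qs i"
    using assms(5) o(2) unfolding remaining_def by auto
  then have "set (listing p ! i) \<subseteq> set ?o \<union> set ?q"
    using q(2) by blast
  also have "\<dots> = set (?o @ tl ?q)"
    using o(1) q(1) by (cases ?q) (auto simp: walk_between_def walk_def)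
  finally have "length (listing p ! i) \<le> num_leaves (?o @ tl ?q)"
    using card_le_num_leaves[of "set (listing p ! i)" "?o @ tl ?q"] xs distinct_card[OF xs(2)] by force
  moreover have "walk_len ?I (?o @ tl ?q) = walk_len ?I ?o + walk_len ?I ?q"
    using o q by (intro walk_len_append_tl) (auto simp: walk_between_def walk_def)
  moreover have "walk_len ?I (?o @ tl ?q) = 2 * real (num_leaves (?o @ tl ?q))"
    using walk_len_star[of kt kd D "?o @ tl ?q"] w by (simp add: walk_between_def)
  ultimately show ?thesis
    by linarith
qed

text \<open>The segment of a drone is part of a listing, so it has at most \<open>M\<close> leaves,
  each costing at most 2 time units at speed 1.\<close>

lemma drone_time_le_star:
  assumes "first_stage (star kt kd D) p" "length (listing p) = kt"
    and "\<And>xs. xs \<in> set (listing p) \<Longrightarrow> length xs \<le> M" "w \<in> set (concat (drone_walks p))"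
  shows "walk_len (star kt kd D) w \<le> 2 * real M"
proof -
  let ?I = "star kt kd D"
  have len: "length (segments p) = kt"
    and all: "list_all2 (list_all2 (joins ?I))
      (map (\<lambda>segs. map (\<lambda>seg. tour_seq ?I (rev seg)) (tl segs)) (segments p)) (drone_walks p)"
    using assms(1) unfolding first_stage_def star_simps by blast+
  obtain i where i: "i < kt" "w \<in> set (drone_walks p ! i)"
  proof -
    obtain ws where "ws \<in> set (drone_walks p)" "w \<in> set ws"
      using assms(4) by auto
    then show ?thesis
      using that len list_all2_lengthD[OF all] by (metis in_set_conv_nth length_map)
  qed
  obtain k where k: "k < length (drone_walks p ! i)" "w = drone_walks p ! i ! k"
    using i(2) by (auto simp: in_set_conv_nth)
  define seg where "seg = tl (segments p ! i) ! k"
  have all_i: "list_all2 (joins ?I)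
      (map (\<lambda>seg. tour_seq ?I (rev seg)) (tl (segments p ! i))) (drone_walks p ! i)"
    using list_all2_nthD[OF all, of i] i len by simp
  have "k < length (tl (segments p ! i))"
    using k(1) list_all2_lengthD[OF all_i] by simp
  then have seg: "seg \<in> set (tl (segments p ! i))" "joins ?I (tour_seq ?I (rev seg)) w"
    using list_all2_nthD2[OF all_i k(1)] unfolding k(2) seg_def by simp_all
  note t = truck_out_star[OF assms(1) i(1)]
  have l: "listing p ! i \<in> set (listing p)"
    using i assms(2) by simp
  have "seg \<in> set (segments p ! i)"
    using seg(1) by (cases "segments p ! i") auto
  then have "set seg \<subseteq> set (concat (segments p ! i))"
    by auto
  then have sub: "set seg \<subseteq> {1..kt + kd}"
    using set_listing_star(1)[OF assms(1) l] unfolding t(2) by blast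
  have "length seg \<le> length (concat (tl (segments p ! i)))"
    using split_list[OF seg(1)] by auto
  then have "length seg \<le> M"
    using t(5) assms(3)[OF l] by linarith
  moreover have "set (tour_seq ?I (rev seg)) \<subseteq> {..kt + kd}"
    using sub by (auto simp: tour_seq_def)
  then have "walk_len ?I w \<le> 2 * real (num_leaves seg)"
    using walk_len_joins_le_star[OF seg(2)] by (simp add: tour_seq_def)
  ultimately show ?thesis
    using num_leaves_le_length[of seg] by linarith
qed

text \<open>Truck \<open>i\<close> needs exactly \<open>2 * M\<close>, and every other vehicle is
  bounded by this value because no listing exceeds \<open>M\<close> leaves.\<close>

lemma completion_time_star:
  assumes "kt \<ge> 1" "kt + kd \<le> kt * M"
    and "first_stage (star kt kd D) p" "second_stage (star kt kd D) p qs"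
    and "i < kt" "length (listing p ! i) = M"
    and "set (listing p ! i) \<subseteq> set (truck_segment (segments p ! i)) \<union> D"
  shows "completion_time (star kt kd D) p qs = 2 * real M"
proof -
  let ?I = "star kt kd D"
  note l = length_listing_star[OF assms(1-3)]
  have "walk_len ?I (truck_out p ! i) + walk_len ?I (qs ! i) = 2 * real M"
    using truck_time_ge_star[OF assms(3-5) l(1) assms(7)]
      truck_time_le_star[OF assms(3-5) l(1)] assms(6) by simp
  moreover have "walk_len ?I (truck_out p ! j) + walk_len ?I (qs ! j) \<le> 2 * real M" if "j < kt" for j
    using truck_time_le_star[OF assms(3,4) that l(1)] l(2)[of "listing p ! j"] that l(1)
    by (simp add: order_trans)
  moreover have "walk_len ?I w \<le> 2 * real M" if "w \<in> set (concat (drone_walks p))" for w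
    using drone_time_le_star[OF assms(3) l that] .
  ultimately show ?thesis
    unfolding completion_time_def using assms(5)
    by (intro Max_eqI) (auto intro!: rev_image_eqI[of i])
qed

section \<open>Pigeonhole and the choice of damaged leaves\<close>

text \<open>The listings are disjoint and without repetition, so their lengths add up to
  \<open>kt + kd\<close>, too much for \<open>kt\<close> lists of length at most
  \<open>m\<close>.\<close>

lemma long_listing_star:
  assumes "first_stage (star kt kd D) p" "length (listing p) = kt" "kt * m < kt + kd"
  obtains i where "i < kt" "m < length (listing p ! i)"
proof -
  have "distinct (concat (listing p))" and "set (concat (listing p)) = {1..kt + kd}"
    using assms(1) unfolding first_stage_def star_simps by blast+
  then have sum: "sum_list (map length (listing p)) = kt + kd"
    using distinct_card[of "concat (listing p)"] by (simp add: length_concat)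
  have "\<exists>i < kt. m < length (listing p ! i)"
  proof (rule ccontr)
    assume "\<not> ?thesis"
    then have "\<forall>xs \<in> set (listing p). length xs \<le> m"
      using assms(2) by (metis in_set_conv_nth not_less)
    then have "sum_list (map length (listing p)) \<le> sum_list (map (\<lambda>_. m) (listing p))"
      by (intro sum_list_mono) auto
    also have "\<dots> = kt * m"
      using assms(2) by (simp add: sum_list_triv)
    finally show False
      using sum assms(3) by linarith
  qed
  then show ?thesis
    using that by blast
qed

theorem lemma21:
  fixes \<alpha> :: real and kt kd :: nat and \<pi> :: "nat policy"
  assumes "\<alpha> = 1" and "kd \<ge> 1" and "kt \<ge> 1"
    and "real kt \<ge> \<alpha> * real_of_int \<lceil>real kd / real kt\<rceil>"
    and "regretless_policy \<pi>"
  shows "\<exists>I :: nat rdp. rdp_instance I \<and> trucks I = kt \<and> drones I = kd \<and> speed I = \<alpha> \<and>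
           Regretless \<pi> I / OPT I = 1 + \<alpha> * real_of_int \<lceil>real kd / real kt\<rceil>"
proof -
  define m where "m = nat \<lceil>real kd / real kt\<rceil>"
  have m: "real_of_int \<lceil>real kd / real kt\<rceil> = real m"
    unfolding m_def using assms(3) by (simp add: order_trans[OF _ le_of_int_ceiling])
  have "m \<le> kt"
    using assms(1,4) m by simp
  \<comment> \<open>Multiplied by \<open>kt\<close>, the two ceiling bounds say that
    \<open>m + 1\<close> leaves per truck suffice and \<open>m\<close> do not.\<close>
  have "real kd / real kt \<le> real m" "real m < real kd / real kt + 1"
    using m ceiling_correct[of "real kd / real kt"] by linarith+
  then have "real kd \<le> real kt * real m" "real kt * real m < real kd + real kt"
    using assms(3) by (simp_all add: field_simps)
  then have up: "kt + kd \<le> kt * Suc m" and lo: "kt * m < kt + kd"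
    by (simp_all flip: of_nat_mult of_nat_add)

  \<comment> \<open>The plan does not depend on the damaged nodes, so it can be read off the
    undamaged star before the adversary chooses \<open>D\<close>.\<close>
  let ?p = "plan_of \<pi> (star kt kd {})"
  have stage: "first_stage (star kt kd D) ?p \<and>
      second_stage (star kt kd D) ?p (returns_of \<pi> (star kt kd D)) \<and>
      plan_of \<pi> (star kt kd D) = ?p" if "D \<subseteq> {1..kt + kd}" for D
  proof -
    have "rdp_instance (star kt kd D)" "rdp_instance (star kt kd {})"
      using rdp_instance_star assms(2,3) that by auto
    moreover have "plan_of \<pi> (star kt kd {}\<lparr>damaged := D\<rparr>) = ?p"
      using assms(5) calculation(2) that unfolding regretless_policy_def by auto
    ultimately show ?thesis
      using assms(5) unfolding regretless_policy_def damaged_update_star by metis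
  qed
  have fs: "first_stage (star kt kd {}) ?p"
    using stage by blast
  note l = length_listing_star[OF assms(3) up fs]
  obtain i where i: "i < kt" "m < length (listing ?p ! i)"
    using long_listing_star[OF fs l(1) lo] by blast
  have li: "listing ?p ! i \<in> set (listing ?p)"
    using i(1) l(1) by simp
  then have len: "length (listing ?p ! i) = Suc m"
    using l(2) i(2) by (simp add: le_antisym Suc_leI)
  note t = truck_out_star[OF fs i(1)]

  \<comment> \<open>\<open>tl\<close> removes the truck's segment, leaving exactly the leaves handed
    to drones.\<close>
  define D where "D = set (concat (tl (segments ?p ! i)))"
  have parts: "set (listing ?p ! i) = set (truck_segment (segments ?p ! i)) \<union> D"
    unfolding t(2)[symmetric] D_def truck_segment_def by (cases "segments ?p ! i") auto
  then have D: "D \<subseteq> {1..kt + kd}"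
    using set_listing_star(1)[OF fs li] by blast
  \<comment> \<open>One of the \<open>m + 1\<close> leaves belongs to the truck's segment, so at
    most \<open>m \<le> kt\<close> are damaged.\<close>
  have "length (truck_segment (segments ?p ! i)) \<ge> 1"
    using t(3) len by (cases "truck_segment (segments ?p ! i)") auto
  then have "card D \<le> m"
    using t(5) len card_length[of "concat (tl (segments ?p ! i))"] by (simp add: D_def)
  then have "OPT (star kt kd D) = 2"
    using OPT_star assms(3) D \<open>m \<le> kt\<close> by simp
  moreover have "Regretless \<pi> (star kt kd D) = 2 * real (Suc m)"
    unfolding Regretless_def
    using stage[OF D] completion_time_star[OF assms(3) up _ _ i(1) len] parts by simp
  ultimately have "Regretless \<pi> (star kt kd D) / OPT (star kt kd D) = 1 + real m"
    by simp
  then show ?thesis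
    using rdp_instance_star[OF assms(3,2) D] m assms(1) by (intro exI[of _ "star kt kd D"]) simp
qed

end
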